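(* Let $k,n\ge1$ be integers and let $\omega:[0,\infty)\to[0,\infty)$ be a continuous, concave, strictly increasing function with $\omega(0)=0$. For every $T=(P,x)$ and $T'=(P',x')$ in $\mathcal P_k\times\mathbb R^n$ we have: (i) $$e^{-n}\delta_\omega(T,T')\le d_\omega(T,T')\le\delta_\omega(T,T');$$ (ii) $$e^{-n}d_\omega(T,T')\le\max_{|\alpha|\le k}\{\omega(\|x-x'\|),\ \varphi_\alpha(|D^\alpha(P-P')(x)|)\}\le e^n d_\omega(T,T').$$
   Context: $\|\cdot\|$ on $\mathbb R^n$ is the Euclidean norm; $\mathcal P_k$ is the space of real polynomials on $\mathbb R^n$ of degree at most $k$. For a multi-index $\alpha$ with $|\alpha|<k$ let $\psi_\alpha:[0,\infty)\to[0,\infty)$ be the inverse of the strictly increasing function $s\mapsto s^{k-|\alpha|}\omega(s)$ and put $\varphi_\alpha:=\omega\circ\psi_\alpha$; for $|\alpha|=k$ put $\varphi_\alpha(t):=t$. For $T_0=(P_0,x_0)$, $T_1=(P_1,x_1)$ in $\mathcal P_k\times\mathbb R^n$ let $$\delta_\omega(T_0,T_1):=\max_{|\alpha|\le k}\{\omega(\|x_0-x_1\|),\ \varphi_\alpha(|D^\alpha(P_0-P_1)(x_0)|),\ \varphi_\alpha(|D^\alpha(P_0-P_1)(x_1)|)\},$$ and let $d_\omega(T,T'):=\inf\sum_{i=0}^{m-1}\delta_\omega(T_i,T_{i+1})$, the infimum being over all finite families $\{T_0,\dots,T_m\}\subset\mathcal P_k\times\mathbb R^n$ with $T_0=T$,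 $T_m=T'$. *)

theory Defs
  imports "HOL-Analysis.Analysis" "HOL-Library.Multiset"
begin

text \<open>Multi-indices on \<open>\<real>\<^sup>n\<close> are functions \<open>\<alpha> :: 'n \<Rightarrow> nat\<close>, where \<open>n = CARD('n)\<close>.\<close>

definition mi_order :: "('n::finite \<Rightarrow> nat) \<Rightarrow> nat" where
  "mi_order \<alpha> = (\<Sum>i\<in>UNIV. \<alpha> i)"

definition monomial_fun :: "('n::finite \<Rightarrow> nat) \<Rightarrow> real^'n \<Rightarrow> real" where
  "monomial_fun \<alpha> x = (\<Prod>i\<in>UNIV. (x $ i) ^ \<alpha> i)"

definition poly_space :: "nat \<Rightarrow> (real^'n::finite \<Rightarrow> real) set" where
  "poly_space k = {P. \<exists>c. P = (\<lambda>x. \<Sum>\<alpha> | mi_order \<alpha> \<le> k. c \<alpha> * monomial_fun \<alpha> x)}"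

definition partial_deriv :: "'n::finite \<Rightarrow> (real^'n \<Rightarrow> real) \<Rightarrow> (real^'n \<Rightarrow> real)" where
  "partial_deriv i f = (\<lambda>x. deriv (\<lambda>t. f (x + t *\<^sub>R axis i 1)) 0)"

text \<open>The index type carries no order, so the partial derivatives are taken in the order of an
  arbitrary fixed enumeration of the coordinates. For polynomials the enumeration is irrelevant,
  see \<open>D_multi_enum_irrelevant\<close> below.\<close>

definition coord_enum :: "'n::finite list" where
  "coord_enum = (SOME xs. distinct xs \<and> set xs = UNIV)"

definition D_multi :: "('n::finite \<Rightarrow> nat) \<Rightarrow> (real^'n \<Rightarrow> real) \<Rightarrow> (real^'n \<Rightarrow> real)" where
  "D_multi \<alpha> f = fold (\<lambda>i. partial_deriv i ^^ \<alpha> i) coord_enum f"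

definition psi :: "(real \<Rightarrow> real) \<Rightarrow> nat \<Rightarrow> ('n::finite \<Rightarrow> nat) \<Rightarrow> real \<Rightarrow> real" where
  "psi \<omega> k \<alpha> = the_inv_into {0..} (\<lambda>s. s ^ (k - mi_order \<alpha>) * \<omega> s)"

definition phi :: "(real \<Rightarrow> real) \<Rightarrow> nat \<Rightarrow> ('n::finite \<Rightarrow> nat) \<Rightarrow> real \<Rightarrow> real" where
  "phi \<omega> k \<alpha> t = (if mi_order \<alpha> < k then \<omega> (psi \<omega> k \<alpha> t) else t)"

type_synonym 'n jet = "(real^'n \<Rightarrow> real) \<times> (real^'n)"

definition jet_max ::
  "(real \<Rightarrow> real) \<Rightarrow> nat \<Rightarrow> 'n::finite jet \<Rightarrow> 'n jet \<Rightarrow> real" where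
  "jet_max \<omega> k = (\<lambda>(P, x) (P', x').
     Max (insert (\<omega> (norm (x - x')))
       ((\<lambda>\<alpha>. phi \<omega> k \<alpha> \<bar>D_multi \<alpha> (\<lambda>y. P y - P' y) x\<bar>) ` {\<alpha>. mi_order \<alpha> \<le> k})))"

definition delta ::
  "(real \<Rightarrow> real) \<Rightarrow> nat \<Rightarrow> 'n::finite jet \<Rightarrow> 'n jet \<Rightarrow> real" where
  "delta \<omega> k = (\<lambda>(P\<^sub>0, x\<^sub>0) (P\<^sub>1, x\<^sub>1).
     Max (insert (\<omega> (norm (x\<^sub>0 - x\<^sub>1)))
       ((\<lambda>\<alpha>. phi \<omega> k \<alpha> \<bar>D_multi \<alpha> (\<lambda>y. P\<^sub>0 y - P\<^sub>1 y) x\<^sub>0\<bar>) ` {\<alpha>. mi_order \<alpha> \<le> k} \<union>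
        (\<lambda>\<alpha>. phi \<omega> k \<alpha> \<bar>D_multi \<alpha> (\<lambda>y. P\<^sub>0 y - P\<^sub>1 y) x\<^sub>1\<bar>) ` {\<alpha>. mi_order \<alpha> \<le> k})))"

text \<open>A chain of length \<open>m = 0\<close> is only possible if \<open>T = T'\<close>; it contributes the value \<open>0\<close>,
  which the one-step chain contributes as well since \<open>delta \<omega> k T T = 0\<close>.\<close>

definition d_chain ::
  "(real \<Rightarrow> real) \<Rightarrow> nat \<Rightarrow> 'n::finite jet \<Rightarrow> 'n jet \<Rightarrow> real" where
  "d_chain \<omega> k T T' =
     Inf {(\<Sum>i<m. delta \<omega> k (S i) (S (Suc i))) | m S.
            (\<forall>i\<le>m. S i \<in> poly_space k \<times> UNIV) \<and> S 0 = T \<and> S m = T'}"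

lemma finite_mi_order_le: "finite {\<alpha> :: 'n::finite \<Rightarrow> nat. mi_order \<alpha> \<le> k}"
proof (rule finite_subset)
  show "{\<alpha> :: 'n \<Rightarrow> nat. mi_order \<alpha> \<le> k} \<subseteq> PiE UNIV (\<lambda>_. {..k})"
  proof
    fix \<alpha> :: "'n \<Rightarrow> nat"
    assume "\<alpha> \<in> {\<alpha>. mi_order \<alpha> \<le> k}"
    moreover have "\<alpha> i \<le> mi_order \<alpha>" for i
      unfolding mi_order_def by (rule member_le_sum) auto
    ultimately show "\<alpha> \<in> PiE UNIV (\<lambda>_. {..k})"
      by (auto simp: PiE_UNIV_domain intro: order_trans)
  qed
  show "finite (PiE (UNIV :: 'n set) (\<lambda>_. {..k}))"
    by (intro finite_PiE) auto
qed

lemma coord_enum: "distinct (coord_enum :: 'n::finite list)" "set (coord_enum :: 'n list) = UNIV"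
proof -
  have "\<exists>xs :: 'n list. distinct xs \<and> set xs = UNIV"
    using finite_distinct_list[OF finite[of "UNIV :: 'n set"]] by blast
  from someI_ex[OF this]
  show "distinct (coord_enum :: 'n list)" "set (coord_enum :: 'n list) = UNIV"
    by (auto simp: coord_enum_def)
qed

lemma monomial_fun_line:
  "monomial_fun g (x + t *\<^sub>R axis i 1) =
     (x $ i + t) ^ g i * (\<Prod>j\<in>UNIV - {i}. (x $ j) ^ g j)"
proof -
  have "monomial_fun g (x + t *\<^sub>R axis i 1) =
    (x $ i + t) ^ g i * (\<Prod>j\<in>UNIV - {i}. ((x + t *\<^sub>R axis i 1) $ j) ^ g j)"
    unfolding monomial_fun_def by (subst prod.remove[of _ i]) auto
  also have "(\<Prod>j\<in>UNIV - {i}. ((x + t *\<^sub>R axis i 1) $ j) ^ g j) =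
      (\<Prod>j\<in>UNIV - {i}. (x $ j) ^ g j)"
    by (intro prod.cong) (auto simp: axis_def)
  finally show ?thesis .
qed

lemma partial_deriv_sum_monomials:
  fixes i :: "'n::finite" and g :: "'a \<Rightarrow> 'n \<Rightarrow> nat"
  assumes "finite A"
  shows "partial_deriv i (\<lambda>x. \<Sum>a\<in>A. c a * monomial_fun (g a) x) =
    (\<lambda>x. \<Sum>a\<in>A. (c a * real (g a i)) * monomial_fun ((g a)(i := g a i - 1)) x)"
proof
  fix x :: "real^'n"
  let ?R = "\<lambda>a. \<Prod>j\<in>UNIV - {i}. (x $ j) ^ g a j"
  have "((\<lambda>t. \<Sum>a\<in>A. c a * ((x $ i + t) ^ g a i * ?R a)) has_field_derivative
      (\<Sum>a\<in>A. c a * (real (g a i) * (x $ i) ^ (g a i - 1) * ?R a))) (at 0)"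
  proof (intro DERIV_sum DERIV_cmult DERIV_cmult_right)
    fix a
    show "((\<lambda>t. (x $ i + t) ^ g a i) has_field_derivative
        real (g a i) * (x $ i) ^ (g a i - 1)) (at 0)"
      by (rule derivative_eq_intros refl | simp)+
  qed
  then have "partial_deriv i (\<lambda>x. \<Sum>a\<in>A. c a * monomial_fun (g a) x) x =
      (\<Sum>a\<in>A. c a * (real (g a i) * (x $ i) ^ (g a i - 1) * ?R a))"
    unfolding partial_deriv_def monomial_fun_line by (rule DERIV_imp_deriv)
  also have "\<dots> = (\<Sum>a\<in>A. (c a * real (g a i)) * monomial_fun ((g a)(i := g a i - 1)) x)"
  proof (rule sum.cong)
    fix a
    have "(\<Prod>j\<in>UNIV - {i}. (x $ j) ^ ((g a)(i := g a i - 1)) j) = ?R a"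
      by (intro prod.cong) auto
    with monomial_fun_line[of "(g a)(i := g a i - 1)" x 0 i]
    have "monomial_fun ((g a)(i := g a i - 1)) x = (x $ i) ^ (g a i - 1) * ?R a"
      by (simp only: scaleR_zero_left add_0_right fun_upd_same)
    then show "c a * (real (g a i) * (x $ i) ^ (g a i - 1) * ?R a) =
      (c a * real (g a i)) * monomial_fun ((g a)(i := g a i - 1)) x"
      by (simp only: mult.assoc)
  qed simp
  finally show "partial_deriv i (\<lambda>x. \<Sum>a\<in>A. c a * monomial_fun (g a) x) x =
      (\<Sum>a\<in>A. (c a * real (g a i)) * monomial_fun ((g a)(i := g a i - 1)) x)" .
qed

definition poly_rep :: "(real^'n::finite \<Rightarrow> real) \<Rightarrow> bool" where
  "poly_rep f \<longleftrightarrow> (\<exists>(A :: ('n \<Rightarrow> nat) set) c g. finite A \<and>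
      f = (\<lambda>x. \<Sum>a\<in>A. c a * monomial_fun (g a) x))"

lemma poly_repI:
  fixes A :: "('n::finite \<Rightarrow> nat) set"
  shows "finite A \<Longrightarrow> poly_rep (\<lambda>x :: real^'n. \<Sum>a\<in>A. c a * monomial_fun (g a) x)"
  unfolding poly_rep_def by (intro exI conjI) (assumption, rule refl)

lemma poly_repE:
  fixes f :: "real^'n::finite \<Rightarrow> real"
  assumes "poly_rep f"
  obtains A :: "('n \<Rightarrow> nat) set" and c g
  where "finite A" "f = (\<lambda>x. \<Sum>a\<in>A. c a * monomial_fun (g a) x)"
  using assms unfolding poly_rep_def by (elim exE conjE)

lemma poly_rep_partial_deriv:
  assumes "poly_rep f"
  shows "poly_rep (partial_deriv i f)"
  using assms by (rule poly_repE) (simp only: partial_deriv_sum_monomials poly_repI)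

lemma partial_deriv_commute:
  assumes "poly_rep f"
  shows "partial_deriv i (partial_deriv j f) = partial_deriv j (partial_deriv i f)"
proof (cases "i = j")
  case False
  from assms obtain A c g where A: "finite (A :: ('a \<Rightarrow> nat) set)"
    and f: "f = (\<lambda>x. \<Sum>a\<in>A. c a * monomial_fun (g a) x)"
    by (rule poly_repE)
  have eq: "(g a)(j := g a j - 1, i := ((g a)(j := g a j - 1)) i - 1) =
      (g a)(i := g a i - 1, j := ((g a)(i := g a i - 1)) j - 1)"
    "c a * real (g a j) * real (((g a)(j := g a j - 1)) i) =
      c a * real (g a i) * real (((g a)(i := g a i - 1)) j)" for a
    using False by (auto simp: fun_eq_iff)
  show ?thesis
    unfolding f partial_deriv_sum_monomials[OF A] eq ..
qed simp

lemma poly_rep_funpow: "poly_rep f \<Longrightarrow> poly_rep ((partial_deriv i ^^ m) f)"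
  by (induction m) (auto intro: poly_rep_partial_deriv)

lemma partial_deriv_funpow_commute1:
  assumes "poly_rep f"
  shows "partial_deriv i ((partial_deriv j ^^ m) f) = (partial_deriv j ^^ m) (partial_deriv i f)"
proof (induction m)
  case (Suc m)
  show ?case
    by (simp only: funpow.simps(2) comp_apply Suc.IH[symmetric]
        partial_deriv_commute[OF poly_rep_funpow[OF assms], of i j])
qed simp

lemma partial_deriv_funpow_commute:
  assumes "poly_rep f"
  shows "(partial_deriv i ^^ l) ((partial_deriv j ^^ m) f) =
    (partial_deriv j ^^ m) ((partial_deriv i ^^ l) f)"
proof (induction l)
  case (Suc l)
  have "(partial_deriv i ^^ Suc l) ((partial_deriv j ^^ m) f) =
      partial_deriv i ((partial_deriv j ^^ m) ((partial_deriv i ^^ l) f))"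
    by (simp only: funpow.simps(2) comp_apply Suc.IH)
  also have "\<dots> = (partial_deriv j ^^ m) (partial_deriv i ((partial_deriv i ^^ l) f))"
    by (rule partial_deriv_funpow_commute1[OF poly_rep_funpow[OF assms]])
  finally show ?case by (simp only: funpow.simps(2) comp_apply)
qed simp

lemma poly_space_poly_rep: "P \<in> poly_space k \<Longrightarrow> poly_rep P"
  unfolding poly_space_def by (auto intro: poly_repI finite_mi_order_le)

lemma D_multi_enum_irrelevant:
  fixes P :: "real^'n::finite \<Rightarrow> real"
  assumes "P \<in> poly_space k" "distinct xs" "set xs = (UNIV :: 'n set)"
  shows "D_multi \<alpha> P = fold (\<lambda>i. partial_deriv i ^^ \<alpha> i) xs P"
  unfolding D_multi_def
proof (rule fold_permuted_eq[where P = poly_rep])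
  show "mset (coord_enum :: 'n list) = mset xs"
    using set_eq_iff_mset_eq_distinct[OF coord_enum(1) assms(2)] by (simp add: coord_enum(2) assms(3))
  show "poly_rep P" using assms poly_space_poly_rep by blast
qed (auto intro: poly_rep_funpow partial_deriv_funpow_commute)

end

theory Submission
  imports Defs
begin

text \<open>
  Let \<open>\<Lambda>\<close> be the total length of a chain \<open>T\<^sub>0, \<dots>, T\<^sub>m\<close>, each step being measured only at its
  left point. Concavity makes \<open>\<omega>\<close> subadditive, so if \<open>\<Lambda> = \<omega> r\<close> and the \<open>i\<close>-th step has size
  \<open>\<omega> \<rho>\<^sub>i\<close>, then \<open>\<Sum>\<rho>\<^sub>i \<le> r\<close> and the whole chain stays within distance \<open>r\<close> of its end points. The \<open>i\<close>-th
  difference of polynomials has derivatives of order \<open>|\<alpha>|\<close> at most \<open>r\<^bsup>k-|\<alpha>|\<^esup> \<omega> \<rho>\<^sub>i\<close> at \<open>x\<^sub>i\<close>; Taylor's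
  formula carries this bound to either end point at the cost of a factor
  \<open>\<Sum>1/\<beta>! \<le> e\<^sup>n\<close>. Summing over \<open>i\<close> gives \<open>e\<^sup>n r\<^bsup>k-|\<alpha>|\<^esup> \<omega> r\<close>, and
  \<open>\<phi>\<^sub>\<alpha>\<close> of this is at most \<open>e\<^sup>n \<omega> r\<close>. Chains of one step yield the
  comparison of \<open>\<delta>\<close> with the one-sided maximum. If \<open>\<omega>\<close> is bounded and \<open>\<Lambda>\<close> lies outside its range, only
  the derivatives of order \<open>k\<close> matter, and these are constant.
\<close>

subsection \<open>Taylor's formula for polynomials\<close>

text \<open>The coefficient that appears in the \<open>m\<close>-th derivative of
  \<open>x ^ n\<close>. Truncated subtraction makes the factor with \<open>j = n\<close> zero, so
  the product vanishes for \<open>m > n\<close> without a case distinction.\<close>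

definition falling :: "nat \<Rightarrow> nat \<Rightarrow> real" where
  "falling n m = (\<Prod>j<m. real (n - j))"

lemma falling_0 [simp]: "falling n 0 = 1"
  by (simp add: falling_def)

lemma falling_Suc: "falling n (Suc m) = falling n m * real (n - m)"
  by (simp add: falling_def)

lemma falling_add: "falling n (a + b) = falling n a * falling (n - a) b"
  by (induction b) (simp_all add: falling_Suc)

lemma falling_eq_binomial: "falling n m = real (n choose m) * fact m"
proof (induction m)
  case (Suc m)
  \<comment> \<open>Absorption identity for binomial coefficients; for \<open>n \<le> m\<close> both
    sides are 0.\<close>
  have "(n - m) * (n choose m) = Suc m * (n choose Suc m)"
    by (cases n) (simp_all only: binomial_absorb_comp Suc_times_binomial_eq diff_0_eq_0
        binomial_0_Suc mult_0 mult_0_right Suc_times_binomial diff_Suc_1 binomial_absorption)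
  then have "real (n - m) * real (n choose m) = real (Suc m) * real (n choose Suc m)"
    by (simp only: of_nat_mult[symmetric])
  then show ?case
    by (simp add: falling_Suc Suc algebra_simps)
qed simp

definition multi_falling :: "('n::finite \<Rightarrow> nat) \<Rightarrow> ('n \<Rightarrow> nat) \<Rightarrow> real" where
  "multi_falling \<gamma> \<alpha> = (\<Prod>i\<in>UNIV. falling (\<gamma> i) (\<alpha> i))"

definition multi_fact :: "('n::finite \<Rightarrow> nat) \<Rightarrow> real" where
  "multi_fact \<alpha> = (\<Prod>i\<in>UNIV. fact (\<alpha> i))"

text \<open>Lets sums over \<beta> \<le> \<gamma> be extended by zero terms to an index set that
  does not depend on \<gamma>.\<close>

lemma multi_falling_eq_0:
  assumes "\<not> (\<forall>i. \<alpha> i \<le> \<gamma> i)"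
  shows "multi_falling \<gamma> \<alpha> = 0"
  using assms by (auto simp: multi_falling_def falling_eq_binomial not_le binomial_eq_0)

lemma multi_falling_add:
  "multi_falling \<gamma> (\<lambda>i. \<alpha> i + \<beta> i) = multi_falling \<gamma> \<alpha> * multi_falling (\<lambda>i. \<gamma> i - \<alpha> i) \<beta>"
  by (simp add: multi_falling_def falling_add prod.distrib)

lemma mi_order_add: "mi_order (\<lambda>i. \<alpha> i + \<beta> i) = mi_order \<alpha> + mi_order \<beta>"
  by (simp add: mi_order_def sum.distrib)

lemma mi_order_diff:
  assumes "\<forall>i. \<alpha> i \<le> \<gamma> i"
  shows "mi_order (\<lambda>i. \<gamma> i - \<alpha> i) = mi_order \<gamma> - mi_order \<alpha>"
  using assms by (simp add: mi_order_def sum_subtractf_nat)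

lemma mi_order_mono: "(\<forall>i. \<alpha> i \<le> \<gamma> i) \<Longrightarrow> mi_order \<alpha> \<le> mi_order \<gamma>"
  by (simp add: mi_order_def sum_mono)

lemma mi_order_ge: "\<alpha> i \<le> mi_order \<alpha>"
  unfolding mi_order_def by (rule member_le_sum) auto

section \<open>Derivatives of polynomials in coefficient form\<close>

lemma partial_deriv_funpow_sum_monomials:
  fixes i :: "'n::finite" and g :: "'a \<Rightarrow> 'n \<Rightarrow> nat"
  assumes "finite A"
  shows "(partial_deriv i ^^ m) (\<lambda>x. \<Sum>a\<in>A. c a * monomial_fun (g a) x) =
    (\<lambda>x. \<Sum>a\<in>A. (c a * falling (g a i) m) * monomial_fun ((g a)(i := g a i - m)) x)"
proof (induction m)
  case (Suc m)
  have "((g a)(i := g a i - m))(i := ((g a)(i := g a i - m)) i - 1) = (g a)(i := g a i - Suc m)" for a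
    by (simp add: fun_eq_iff)
  then show ?case
    by (simp only: funpow.simps comp_apply Suc partial_deriv_sum_monomials[OF assms] falling_Suc
        fun_upd_same mult.assoc[symmetric])
qed simp

text \<open>The exponents stay a family \<open>g\<close> over a fixed index set and like terms are
  never collected, so differentiation changes only coefficients and exponents. Where an exponent is
  truncated at 0, the coefficient is 0 too.\<close>

lemma fold_partial_deriv_sum_monomials:
  fixes g :: "'a \<Rightarrow> 'n::finite \<Rightarrow> nat"
  assumes "finite A" "distinct xs"
  shows "fold (\<lambda>i. partial_deriv i ^^ \<alpha> i) xs (\<lambda>x. \<Sum>a\<in>A. c a * monomial_fun (g a) x) =
    (\<lambda>x. \<Sum>a\<in>A. (c a * (\<Prod>i\<in>set xs. falling (g a i) (\<alpha> i))) *
       monomial_fun (\<lambda>j. if j \<in> set xs then g a j - \<alpha> j else g a j) x)"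
  using assms(2)
proof (induction xs arbitrary: c g)
  case (Cons i xs)
  let ?g = "\<lambda>a. (g a)(i := g a i - \<alpha> i)"
  \<comment> \<open>By distinctness \<open>i\<close> is not in \<open>set xs\<close>, so the
    remaining derivatives leave the exponent lowered at \<open>i\<close> alone.\<close>
  have "(\<lambda>j. if j \<in> set xs then ?g a j - \<alpha> j else ?g a j) =
      (\<lambda>j. if j \<in> set (i # xs) then g a j - \<alpha> j else g a j)" for a
    using Cons.prems by (auto simp: fun_eq_iff)
  moreover have "(\<Prod>j\<in>set xs. falling (?g a j) (\<alpha> j)) = (\<Prod>j\<in>set xs. falling (g a j) (\<alpha> j))" for a
    using Cons.prems by (intro prod.cong) auto
  moreover have "(\<Prod>j\<in>set (i # xs). falling (g a j) (\<alpha> j)) =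
      falling (g a i) (\<alpha> i) * (\<Prod>j\<in>set xs. falling (g a j) (\<alpha> j))" for a
    using Cons.prems by simp
  moreover have "distinct xs" using Cons.prems by simp
  ultimately show ?case
    by (simp only: fold_simps partial_deriv_funpow_sum_monomials[OF assms(1)] Cons.IH mult.assoc[symmetric])
qed simp

lemma D_multi_sum_monomials:
  fixes g :: "'a \<Rightarrow> 'n::finite \<Rightarrow> nat"
  assumes "finite A"
  shows "D_multi \<alpha> (\<lambda>x. \<Sum>a\<in>A. c a * monomial_fun (g a) x) =
    (\<lambda>x. \<Sum>a\<in>A. c a * multi_falling (g a) \<alpha> * monomial_fun (\<lambda>i. g a i - \<alpha> i) x)"
  unfolding D_multi_def fold_partial_deriv_sum_monomials[OF assms coord_enum(1)]
  by (simp add: coord_enum(2) multi_falling_def)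

lemma poly_spaceE:
  assumes "P \<in> poly_space k"
  obtains c where "P = (\<lambda>x. \<Sum>\<alpha> | mi_order \<alpha> \<le> k. c \<alpha> * monomial_fun \<alpha> x)"
  using assms by (auto simp: poly_space_def)

lemma poly_space_diff:
  assumes "P \<in> poly_space k" "Q \<in> poly_space k"
  shows "(\<lambda>y. P y - Q y) \<in> poly_space k"
proof -
  from assms obtain c d where "P = (\<lambda>x. \<Sum>\<alpha> | mi_order \<alpha> \<le> k. c \<alpha> * monomial_fun \<alpha> x)"
    "Q = (\<lambda>x. \<Sum>\<alpha> | mi_order \<alpha> \<le> k. d \<alpha> * monomial_fun \<alpha> x)"
    by (elim poly_spaceE)
  then show ?thesis
    unfolding poly_space_def
    by (auto simp: fun_eq_iff sum_subtractf algebra_simps intro!: exI[of _ "\<lambda>\<alpha>. c \<alpha> - d \<alpha>"])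
qed

text \<open>\<open>deriv\<close> is not additive on arbitrary functions; linearity is read off from
  the coefficient formula.\<close>

lemma D_multi_diff:
  assumes "P \<in> poly_space k" "Q \<in> poly_space k"
  shows "D_multi \<alpha> (\<lambda>y. P y - Q y) x = D_multi \<alpha> P x - D_multi \<alpha> Q x"
proof -
  from assms obtain c d where P: "P = (\<lambda>x. \<Sum>\<alpha> | mi_order \<alpha> \<le> k. c \<alpha> * monomial_fun \<alpha> x)"
    and Q: "Q = (\<lambda>x. \<Sum>\<alpha> | mi_order \<alpha> \<le> k. d \<alpha> * monomial_fun \<alpha> x)"
    by (elim poly_spaceE)
  have "(\<lambda>y. P y - Q y) = (\<lambda>x. \<Sum>\<alpha> | mi_order \<alpha> \<le> k. (c \<alpha> - d \<alpha>) * monomial_fun \<alpha> x)"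
    by (simp add: P Q fun_eq_iff sum_subtractf algebra_simps)
  then show ?thesis
    by (simp only: P Q D_multi_sum_monomials[OF finite_mi_order_le])
      (simp add: sum_subtractf algebra_simps)
qed

section \<open>Expansion of monomials and polynomials about a point\<close>

lemma power_add_falling:
  "(y + h) ^ g = (\<Sum>b\<le>g. falling g b * y ^ (g - b) * h ^ b / fact b)" for y h :: real
  by (subst add.commute, subst binomial_ring) (simp add: falling_eq_binomial algebra_simps)

text \<open>Multiplying out the one-variable binomial expansions gives one summand for each \<beta>
  \<le> \<gamma>. Zero terms extend the range to |\<beta>| \<le> \<open>K\<close>, so that for
  polynomials the sums over \<gamma> and \<beta> can be swapped.\<close>

lemma monomial_fun_add:
  fixes y h :: "real^'n::finite"
  assumes "mi_order \<gamma> \<le> K"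
  shows "monomial_fun \<gamma> (y + h) = (\<Sum>\<beta> | mi_order \<beta> \<le> K.
    multi_falling \<gamma> \<beta> * monomial_fun (\<lambda>i. \<gamma> i - \<beta> i) y * monomial_fun \<beta> h / multi_fact \<beta>)"
proof -
  have "monomial_fun \<gamma> (y + h) = (\<Prod>i\<in>UNIV. \<Sum>b\<in>{..\<gamma> i}.
      falling (\<gamma> i) b * (y $ i) ^ (\<gamma> i - b) * (h $ i) ^ b / fact b)"
    by (simp add: monomial_fun_def power_add_falling)
  also have "\<dots> = (\<Sum>\<beta>\<in>PiE UNIV (\<lambda>i. {..\<gamma> i}). \<Prod>i\<in>UNIV.
      falling (\<gamma> i) (\<beta> i) * (y $ i) ^ (\<gamma> i - \<beta> i) * (h $ i) ^ \<beta> i / fact (\<beta> i))"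
    by (rule prod_sum_PiE) auto
  also have "\<dots> = (\<Sum>\<beta>\<in>PiE UNIV (\<lambda>i. {..\<gamma> i}).
      multi_falling \<gamma> \<beta> * monomial_fun (\<lambda>i. \<gamma> i - \<beta> i) y * monomial_fun \<beta> h / multi_fact \<beta>)"
    by (simp add: multi_falling_def monomial_fun_def multi_fact_def prod.distrib prod_dividef)
  also have "\<dots> = (\<Sum>\<beta> | mi_order \<beta> \<le> K.
      multi_falling \<gamma> \<beta> * monomial_fun (\<lambda>i. \<gamma> i - \<beta> i) y * monomial_fun \<beta> h / multi_fact \<beta>)"
  proof (rule sum.mono_neutral_left[OF finite_mi_order_le])
    show "PiE UNIV (\<lambda>i. {..\<gamma> i}) \<subseteq> {\<beta>. mi_order \<beta> \<le> K}"
      using assms by (auto simp: PiE_UNIV_domain intro: order_trans[OF mi_order_mono])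
  next
    show "\<forall>\<beta>\<in>{\<beta>. mi_order \<beta> \<le> K} - PiE UNIV (\<lambda>i. {..\<gamma> i}). multi_falling \<gamma> \<beta> *
        monomial_fun (\<lambda>i. \<gamma> i - \<beta> i) y * monomial_fun \<beta> h / multi_fact \<beta> = 0"
    proof
      fix \<beta> assume "\<beta> \<in> {\<beta>. mi_order \<beta> \<le> K} - PiE UNIV (\<lambda>i. {..\<gamma> i})"
      then have "\<not> (\<forall>i. \<beta> i \<le> \<gamma> i)" by (auto simp: PiE_UNIV_domain)
      then have "multi_falling \<gamma> \<beta> = 0" by (rule multi_falling_eq_0)
      then show "multi_falling \<gamma> \<beta> * monomial_fun (\<lambda>i. \<gamma> i - \<beta> i) y *
          monomial_fun \<beta> h / multi_fact \<beta> = 0"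
        by simp
    qed
  qed
  finally show ?thesis .
qed

lemma taylor_poly_space:
  fixes y h :: "real^'n::finite"
  assumes "Q \<in> poly_space k"
  shows "D_multi \<alpha> Q (y + h) = (\<Sum>\<beta> :: 'n \<Rightarrow> nat | mi_order \<beta> \<le> k - mi_order \<alpha>.
    D_multi (\<lambda>i. \<alpha> i + \<beta> i) Q y * monomial_fun \<beta> h / multi_fact \<beta>)"
proof -
  from assms obtain c where Q: "Q = (\<lambda>x. \<Sum>\<gamma> :: 'n \<Rightarrow> nat | mi_order \<gamma> \<le> k. c \<gamma> * monomial_fun \<gamma> x)"
    by (elim poly_spaceE)
  let ?K = "k - mi_order \<alpha>"
  have "D_multi \<alpha> Q (y + h) = (\<Sum>\<gamma> :: 'n \<Rightarrow> nat | mi_order \<gamma> \<le> k. \<Sum>\<beta> :: 'n \<Rightarrow> nat | mi_order \<beta> \<le> ?K. c \<gamma> *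
      multi_falling \<gamma> (\<lambda>i. \<alpha> i + \<beta> i) * monomial_fun (\<lambda>i. \<gamma> i - (\<alpha> i + \<beta> i)) y *
      monomial_fun \<beta> h / multi_fact \<beta>)"
    unfolding Q D_multi_sum_monomials[OF finite_mi_order_le]
  proof (rule sum.cong)
    fix \<gamma> :: "'n \<Rightarrow> nat" assume \<gamma>: "\<gamma> \<in> {\<gamma>. mi_order \<gamma> \<le> k}"
    show "c \<gamma> * multi_falling \<gamma> \<alpha> * monomial_fun (\<lambda>i. \<gamma> i - \<alpha> i) (y + h) =
      (\<Sum>\<beta> :: 'n \<Rightarrow> nat | mi_order \<beta> \<le> ?K. c \<gamma> * multi_falling \<gamma> (\<lambda>i. \<alpha> i + \<beta> i) *
        monomial_fun (\<lambda>i. \<gamma> i - (\<alpha> i + \<beta> i)) y * monomial_fun \<beta> h / multi_fact \<beta>)"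
    \<comment> \<open>If \<alpha> \<le> \<gamma> fails,
      \<open>multi_falling \<gamma> \<alpha>\<close> is 0, and it is a factor of every term on the
      right.\<close>
    proof (cases "\<forall>i. \<alpha> i \<le> \<gamma> i")
      case True
      then have "mi_order (\<lambda>i. \<gamma> i - \<alpha> i) \<le> ?K"
        using \<gamma> by (simp add: mi_order_diff diff_le_mono)
      then show ?thesis
        by (simp add: monomial_fun_add multi_falling_add sum_distrib_left mult.assoc)
    qed (simp add: multi_falling_add multi_falling_eq_0)
  qed simp
  also have "\<dots> = (\<Sum>\<beta> :: 'n \<Rightarrow> nat | mi_order \<beta> \<le> ?K. \<Sum>\<gamma> :: 'n \<Rightarrow> nat | mi_order \<gamma> \<le> k. c \<gamma> *
      multi_falling \<gamma> (\<lambda>i. \<alpha> i + \<beta> i) * monomial_fun (\<lambda>i. \<gamma> i - (\<alpha> i + \<beta> i)) y *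
      monomial_fun \<beta> h / multi_fact \<beta>)"
    by (rule sum.swap)
  also have "\<dots> = (\<Sum>\<beta> :: 'n \<Rightarrow> nat | mi_order \<beta> \<le> ?K.
      D_multi (\<lambda>i. \<alpha> i + \<beta> i) Q y * monomial_fun \<beta> h / multi_fact \<beta>)"
    unfolding Q D_multi_sum_monomials[OF finite_mi_order_le]
    by (simp add: sum_distrib_right sum_divide_distrib)
  finally show ?thesis .
qed

section \<open>Moving derivative bounds from one point to another\<close>

lemma sum_inverse_multi_fact_le:
  "(\<Sum>\<beta> :: 'n::finite \<Rightarrow> nat | mi_order \<beta> \<le> K. 1 / multi_fact \<beta>) \<le> exp (real CARD('n))"
proof -
  \<comment> \<open>Over the whole box the sum factors into one partial sum of the series for e per
    coordinate.\<close>
  have "(\<Sum>\<beta> :: 'n \<Rightarrow> nat | mi_order \<beta> \<le> K. 1 / multi_fact \<beta>) \<le>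
      (\<Sum>\<beta>\<in>PiE (UNIV :: 'n set) (\<lambda>_. {..K}). 1 / multi_fact \<beta>)"
  proof (rule sum_mono2)
    show "finite (PiE (UNIV :: 'n set) (\<lambda>_. {..K}))"
      by (intro finite_PiE) auto
    show "{\<beta>. mi_order \<beta> \<le> K} \<subseteq> PiE (UNIV :: 'n set) (\<lambda>_. {..K})"
      by (auto simp: PiE_UNIV_domain intro: order_trans[OF mi_order_ge])
  qed (auto simp: multi_fact_def intro!: prod_nonneg)
  also have "\<dots> = (\<Prod>i\<in>(UNIV :: 'n set). \<Sum>b\<in>{..K}. 1 / fact b)"
    by (subst prod_sum_PiE) (auto simp: multi_fact_def prod_dividef)
  also have "\<dots> \<le> (\<Prod>i\<in>(UNIV :: 'n set). exp (1 :: real))"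
  proof (intro prod_mono conjI sum_nonneg)
    have "(\<Sum>b\<le>K. inverse (fact b) * 1 ^ b) \<le> (\<Sum>b. inverse (fact b) * (1 :: real) ^ b)"
      using summable_exp[of "1 :: real"] by (intro sum_le_suminf) auto
    then show "(\<Sum>b\<le>K. 1 / fact b) \<le> exp (1 :: real)"
      by (simp add: exp_def divide_inverse)
  qed auto
  also have "\<dots> = exp (real CARD('n))"
    by (simp add: exp_of_nat_mult[symmetric])
  finally show ?thesis .
qed

lemma abs_monomial_fun_le:
  assumes "norm h \<le> r"
  shows "\<bar>monomial_fun \<beta> h\<bar> \<le> r ^ mi_order \<beta>"
proof -
  have "\<bar>monomial_fun \<beta> h\<bar> = (\<Prod>i\<in>UNIV. \<bar>h $ i\<bar> ^ \<beta> i)"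
    by (simp add: monomial_fun_def abs_prod power_abs)
  also have "\<dots> \<le> (\<Prod>i\<in>UNIV. r ^ \<beta> i)"
    using assms component_le_norm_cart[of h] by (intro prod_mono conjI power_mono) (auto intro: order_trans)
  finally show ?thesis
    by (simp add: mi_order_def power_sum)
qed

text \<open>The monomial in Taylor's formula contributes r^|\<beta>|, exactly the power missing from
  the bound on the derivative of order |\<alpha>| + |\<beta>|. So each term is at most
  r^(k-|\<alpha>|) \<open>L\<close> / \<beta>!, and summing the 1/\<beta>! costs e^n.\<close>

lemma D_multi_transport:
  fixes y z :: "real^'n::finite"
  assumes Q: "Q \<in> poly_space k" and \<alpha>: "mi_order \<alpha> \<le> k" and r: "norm (z - y) \<le> r"
    and \<beta>: "\<And>\<beta>. mi_order \<alpha> + mi_order \<beta> \<le> k \<Longrightarrow>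
      \<bar>D_multi (\<lambda>i. \<alpha> i + \<beta> i) Q y\<bar> \<le> r ^ (k - mi_order \<alpha> - mi_order \<beta>) * L"
  shows "\<bar>D_multi \<alpha> Q z\<bar> \<le> exp (real CARD('n)) * (r ^ (k - mi_order \<alpha>) * L)"
proof -
  let ?j = "k - mi_order \<alpha>"
  have r0: "0 \<le> r" using r norm_ge_zero order_trans by blast
  \<comment> \<open>The hypothesis at \<beta> = 0 bounds an absolute value by this product, which is
    therefore nonnegative.\<close>
  have "\<bar>D_multi (\<lambda>i. \<alpha> i + 0) Q y\<bar> \<le> r ^ ?j * L"
    using \<beta>[of "\<lambda>_. 0"] \<alpha> by (simp add: mi_order_def)
  then have nonneg: "0 \<le> r ^ ?j * L" by linarith
  have "D_multi \<alpha> Q z = (\<Sum>\<beta> | mi_order \<beta> \<le> ?j.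
      D_multi (\<lambda>i. \<alpha> i + \<beta> i) Q y * monomial_fun \<beta> (z - y) / multi_fact \<beta>)"
    using taylor_poly_space[OF Q, of \<alpha> y "z - y"] by simp
  also have "\<bar>\<dots>\<bar> \<le> (\<Sum>\<beta> :: 'n \<Rightarrow> nat | mi_order \<beta> \<le> ?j. r ^ ?j * L * (1 / multi_fact \<beta>))"
  proof (rule order_trans[OF sum_abs], rule sum_mono)
    fix \<beta> :: "'n \<Rightarrow> nat" assume "\<beta> \<in> {\<beta>. mi_order \<beta> \<le> ?j}"
    then have le: "mi_order \<beta> \<le> ?j" by simp
    have D: "\<bar>D_multi (\<lambda>i. \<alpha> i + \<beta> i) Q y\<bar> \<le> r ^ (?j - mi_order \<beta>) * L"
      using le \<alpha> by (intro \<beta>) simp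
    have "\<bar>D_multi (\<lambda>i. \<alpha> i + \<beta> i) Q y * monomial_fun \<beta> (z - y)\<bar> \<le>
        r ^ (?j - mi_order \<beta>) * L * r ^ mi_order \<beta>"
      unfolding abs_mult
      using D r by (intro mult_mono abs_monomial_fun_le order_trans[OF abs_ge_zero D]) auto
    also have "\<dots> = r ^ ?j * L"
      using power_add[of r "?j - mi_order \<beta>" "mi_order \<beta>"] le
      by (simp only: le_add_diff_inverse2 mult_ac)
    finally show "\<bar>D_multi (\<lambda>i. \<alpha> i + \<beta> i) Q y * monomial_fun \<beta> (z - y) / multi_fact \<beta>\<bar> \<le>
        r ^ ?j * L * (1 / multi_fact \<beta>)"
      by (simp add: multi_fact_def abs_prod divide_right_mono prod_nonneg)
  qed
  also have "\<dots> = r ^ ?j * L * (\<Sum>\<beta> :: 'n \<Rightarrow> nat | mi_order \<beta> \<le> ?j. 1 / multi_fact \<beta>)"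
    by (simp only: sum_distrib_left)
  also have "\<dots> \<le> r ^ ?j * L * exp (real CARD('n))"
    by (rule mult_left_mono[OF sum_inverse_multi_fact_le nonneg])
  finally show ?thesis by (simp add: mult.commute)
qed

text \<open>Only the term \<beta> = 0 is left in Taylor's formula.\<close>

lemma D_multi_top_order_const:
  fixes y z :: "real^'n::finite"
  assumes "Q \<in> poly_space k" "mi_order \<alpha> = k"
  shows "D_multi \<alpha> Q z = D_multi \<alpha> Q y"
proof -
  have "{\<beta> :: 'n \<Rightarrow> nat. mi_order \<beta> \<le> k - mi_order \<alpha>} = {\<lambda>_. 0}"
    unfolding assms(2) by (auto simp: mi_order_def fun_eq_iff)
  then show ?thesis
    using taylor_poly_space[OF assms(1), of \<alpha> y "z - y"]
    by (simp add: monomial_fun_def multi_fact_def)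
qed

subsection \<open>Moduli of continuity\<close>

locale modulus =
  fixes \<omega> :: "real \<Rightarrow> real"
  assumes nonneg_map: "\<omega> \<in> {0..} \<rightarrow> {0..}"
    and cont: "continuous_on {0..} \<omega>"
    and concave: "concave_on {0..} \<omega>"
    and strict: "strict_mono_on {0..} \<omega>"
    and zero [simp]: "\<omega> 0 = 0"
begin

lemma nonneg: "0 \<le> s \<Longrightarrow> 0 \<le> \<omega> s"
  using nonneg_map by auto

lemma less: "0 \<le> s \<Longrightarrow> s < t \<Longrightarrow> \<omega> s < \<omega> t"
  using strict by (auto simp: strict_mono_on_def)

lemma mono: "0 \<le> s \<Longrightarrow> s \<le> t \<Longrightarrow> \<omega> s \<le> \<omega> t"
  using less[of s t] by (cases "s = t") auto

lemma le_cancel: "0 \<le> t \<Longrightarrow> \<omega> s \<le> \<omega> t \<Longrightarrow> s \<le> t"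
  using less[of t s] by fastforce

text \<open>By concavity and \<open>\<omega> 0 = 0\<close> the graph lies above its chord over
  \<open>[0, a + b]\<close>; the values of the chord at \<open>a\<close> and \<open>b\<close> add up
  to \<open>\<omega> (a + b)\<close>.\<close>

lemma subadditive:
  assumes "0 \<le> a" "0 \<le> b"
  shows "\<omega> (a + b) \<le> \<omega> a + \<omega> b"
proof (cases "a + b = 0")
  case False
  have scale: "t / (a + b) * \<omega> (a + b) \<le> \<omega> t" if t: "0 \<le> t" "t \<le> a + b" for t
  proof -
    define u where "u = t / (a + b)"
    have u: "0 \<le> u" "u \<le> 1" "u * (a + b) = t"
      using t False by (auto simp: u_def field_simps)
    have "(1 - u) * \<omega> 0 + u * \<omega> (a + b) \<le> \<omega> ((1 - u) *\<^sub>R 0 + u *\<^sub>R (a + b))"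
      using concave_onD[OF concave u(1,2), of 0 "a + b"] assms by simp
    then show ?thesis using u by (simp add: u_def)
  qed
  have "\<omega> (a + b) = a / (a + b) * \<omega> (a + b) + b / (a + b) * \<omega> (a + b)"
    using False by (simp flip: distrib_right add_divide_distrib)
  also have "\<dots> \<le> \<omega> a + \<omega> b"
    using assms by (intro add_mono scale) auto
  finally show ?thesis .
qed (use assms nonneg[of a] nonneg[of b] in auto)

lemma sum_le:
  assumes "\<And>i. i \<in> A \<Longrightarrow> 0 \<le> r i"
  shows "\<omega> (\<Sum>i\<in>A. r i) \<le> (\<Sum>i\<in>A. \<omega> (r i))"
  using assms
proof (induction A rule: infinite_finite_induct)
  case (insert i A)
  then show ?case
    using subadditive[of "r i" "\<Sum>i\<in>A. r i"] by (fastforce simp: sum_nonneg)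
qed auto

text \<open>The first case comes from the intermediate value theorem. The second occurs when
  \<omega> is bounded and \<open>v\<close> is at least its supremum, which is not attained by strict
  monotonicity.\<close>

lemma range_cases:
  assumes "0 \<le> v"
  obtains s where "0 \<le> s" "v = \<omega> s" | "\<And>s. 0 \<le> s \<Longrightarrow> \<omega> s < v"
proof (cases "\<exists>s\<ge>0. v \<le> \<omega> s")
  case True
  then obtain t where t: "0 \<le> t" "v \<le> \<omega> t" by blast
  have "\<exists>s\<ge>0. s \<le> t \<and> \<omega> s = v"
    using t assms by (intro IVT') (auto intro: continuous_on_subset[OF cont])
  with that(1) show thesis by blast
qed (use that(2) in force)

lemma power_times_less:
  assumes "0 \<le> s" "s < t"
  shows "s ^ j * \<omega> s < t ^ j * \<omega> t"
proof -
  have "s ^ j * \<omega> s \<le> t ^ j * \<omega> s"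
    using assms nonneg by (intro mult_right_mono power_mono) auto
  also have "\<dots> < t ^ j * \<omega> t"
    using assms less by (intro mult_strict_left_mono) auto
  finally show ?thesis .
qed

section \<open>The functions \<open>phi\<close> in terms of preimages\<close>

lemma phi_ex:
  assumes "mi_order \<alpha> < k" "0 \<le> v"
  obtains s where "0 \<le> s" "v = s ^ (k - mi_order \<alpha>) * \<omega> s" "phi \<omega> k \<alpha> v = \<omega> s"
proof -
  let ?j = "k - mi_order \<alpha>"
  let ?f = "\<lambda>s. s ^ ?j * \<omega> s"
  have pos: "0 < \<omega> 1" using less[of 0 1] by simp
  \<comment> \<open>Chosen so that \<open>t \<ge> 1\<close> and
    \<open>t * \<omega> 1 \<ge> v\<close>. Since \<open>?j\<close> is positive,
    \<open>?f t \<ge> v\<close> even for bounded \<omega>, and the intermediate value theorem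
    applies on \<open>[0, t]\<close>.\<close>
  define t where "t = 1 + v / \<omega> 1"
  have t: "1 \<le> t" using assms pos by (simp add: t_def)
  have "v \<le> t * \<omega> 1" using pos by (simp add: t_def field_simps)
  also have "\<dots> \<le> t ^ ?j * \<omega> t"
    using t assms pos by (intro mult_mono mono self_le_power) auto
  finally have "\<exists>s\<ge>0. s \<le> t \<and> ?f s = v"
    using t assms
    by (intro IVT') (auto intro!: continuous_intros intro: continuous_on_subset[OF cont])
  then obtain s where s: "0 \<le> s" "?f s = v" by blast
  have "inj_on ?f {0..}"
    by (intro linorder_inj_onI') (metis atLeast_iff less_irrefl power_times_less)
  then have "psi \<omega> k \<alpha> v = s"
    unfolding psi_def s(2)[symmetric] using s by (intro the_inv_into_f_f) auto
  with s that assms show thesis by (simp add: phi_def)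
qed

text \<open>Turns a bound on \<open>phi\<close> into one on the derivative itself, to which Taylor's
  formula applies. For the preimage \<open>s\<close> of \<open>v\<close> this is monotonicity of
  \<open>s ^ j * \<omega> s\<close>.\<close>

lemma phi_le_imp_le:
  assumes "mi_order \<alpha> \<le> k" "0 \<le> v" "0 \<le> r" "phi \<omega> k \<alpha> v \<le> \<omega> r"
  shows "v \<le> r ^ (k - mi_order \<alpha>) * \<omega> r"
proof (cases "mi_order \<alpha> < k")
  case True
  from phi_ex[OF True assms(2)] obtain s
    where s: "0 \<le> s" "v = s ^ (k - mi_order \<alpha>) * \<omega> s" "phi \<omega> k \<alpha> v = \<omega> s" by metis
  then have "s \<le> r" using assms le_cancel[of r s] by simp
  then show ?thesis
    unfolding s(2) using s(1) assms nonneg by (intro mult_mono power_mono mono) auto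
qed (use assms in \<open>simp add: phi_def\<close>)

text \<open>If the preimage \<open>s\<close> of \<open>v\<close> exceeds \<open>r\<close>, replacing \<open>r\<close> by \<open>s\<close> in the power only weakens the bound on \<open>v\<close>,
  and the power cancels.\<close>

lemma phi_le_scaled:
  assumes "mi_order \<alpha> \<le> k" "0 \<le> v" "0 \<le> r" "1 \<le> E" "v \<le> E * (r ^ (k - mi_order \<alpha>) * \<omega> r)"
  shows "phi \<omega> k \<alpha> v \<le> E * \<omega> r"
proof (cases "mi_order \<alpha> < k")
  case True
  let ?j = "k - mi_order \<alpha>"
  from phi_ex[OF True assms(2)] obtain s
    where s: "0 \<le> s" "v = s ^ ?j * \<omega> s" "phi \<omega> k \<alpha> v = \<omega> s" by metis
  show ?thesis
  proof (cases "s \<le> r")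
    case True
    then have "\<omega> s \<le> 1 * \<omega> r" using s mono by simp
    also have "\<dots> \<le> E * \<omega> r" using assms nonneg by (intro mult_right_mono) auto
    finally show ?thesis using s by simp
  next
    case False
    have "s ^ ?j * \<omega> s \<le> r ^ ?j * (E * \<omega> r)"
      using assms(5) s(2) by (simp add: mult_ac)
    also have "\<dots> \<le> s ^ ?j * (E * \<omega> r)"
      using False assms nonneg by (intro mult_right_mono power_mono) auto
    finally show ?thesis using s(3) False assms(3) by simp
  qed
qed (use assms in \<open>simp add: phi_def\<close>)

text \<open>Below the top order, every value of \<open>phi\<close> is a value of \<omega>.\<close>

lemma phi_less_of_range_less:
  assumes "\<And>s. 0 \<le> s \<Longrightarrow> \<omega> s < L" "mi_order \<alpha> < k" "0 \<le> v"
  shows "phi \<omega> k \<alpha> v < L"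
  using phi_ex[OF assms(2,3)] assms(1) by metis

end

subsection \<open>Chains of jets\<close>

text \<open>Both maxima enter the later proofs only through their upper bounds.\<close>

lemma jet_max_le_iff:
  "jet_max \<omega> k (P, x) (P', x') \<le> L \<longleftrightarrow> \<omega> (norm (x - x')) \<le> L \<and>
    (\<forall>\<alpha>. mi_order \<alpha> \<le> k \<longrightarrow> phi \<omega> k \<alpha> \<bar>D_multi \<alpha> (\<lambda>y. P y - P' y) x\<bar> \<le> L)"
  unfolding jet_max_def prod.case
  by (subst Max_le_iff) (auto intro: finite_imageI finite_mi_order_le)

lemma delta_le_iff:
  "delta \<omega> k (P, x) (P', x') \<le> L \<longleftrightarrow> jet_max \<omega> k (P, x) (P', x') \<le> L \<and>
    (\<forall>\<alpha>. mi_order \<alpha> \<le> k \<longrightarrow> phi \<omega> k \<alpha> \<bar>D_multi \<alpha> (\<lambda>y. P y - P' y) x'\<bar> \<le> L)"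
  unfolding delta_def prod.case jet_max_le_iff
  by (subst Max_le_iff) (auto intro!: finite_imageI finite_mi_order_le)

lemma jet_max_le_delta: "jet_max \<omega> k T T' \<le> delta \<omega> k T T'"
  using delta_le_iff[of \<omega> k "fst T" "snd T" "fst T'" "snd T'" "delta \<omega> k T T'"] by simp

section \<open>The estimate along a chain\<close>

lemma norm_diff_le_sum:
  fixes f :: "nat \<Rightarrow> 'a::real_normed_vector"
  assumes "\<And>i. i < m \<Longrightarrow> norm (f i - f (Suc i)) \<le> r i" "a \<le> b" "b \<le> m"
  shows "norm (f a - f b) \<le> (\<Sum>i<m. r i)"
proof -
  have "f a - f b = (\<Sum>i = a..<b. f i - f (Suc i))"
    using sum_Suc_diff'[of a b "\<lambda>i. - f i"] assms by simp
  also have "norm \<dots> \<le> (\<Sum>i = a..<b. r i)"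
    using assms by (intro sum_norm_le) auto
  \<comment> \<open>The full sum serves all pairs \<open>a \<le> b\<close> at once; the added terms
    bound norms and so are nonnegative.\<close>
  also have "\<dots> \<le> (\<Sum>i<m. r i)"
    using assms by (intro sum_mono2) (auto intro: order_trans[OF norm_ge_zero])
  finally show ?thesis .
qed

context modulus
begin

lemma jet_max_nonneg: "0 \<le> jet_max \<omega> k T T'"
  using jet_max_le_iff[of \<omega> k "fst T" "snd T" "fst T'" "snd T'" "jet_max \<omega> k T T'"]
    nonneg[OF norm_ge_zero, of "snd T - snd T'"] by auto

text \<open>Measuring the steps by the smaller \<open>jet_max\<close> lets one estimate give both
  the lower bound for \<open>d_chain\<close> and, with \<open>m = 1\<close>, the comparison of
  \<open>delta\<close> with \<open>jet_max\<close>.\<close>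

lemma delta_le_sum_jet_max:
  fixes S :: "nat \<Rightarrow> 'n::finite jet"
  assumes S: "\<forall>i\<le>m. S i \<in> poly_space k \<times> UNIV"
  shows "delta \<omega> k (S 0) (S m) \<le> exp (real CARD('n)) * (\<Sum>i<m. jet_max \<omega> k (S i) (S (Suc i)))"
proof -
  define P where "P i = fst (S i)" for i
  define x where "x i = snd (S i)" for i
  define L where "L i = jet_max \<omega> k (P i, x i) (P (Suc i), x (Suc i))" for i
  define Q where "Q i = (\<lambda>y. P i y - P (Suc i) y)" for i
  define \<Lambda> where "\<Lambda> = (\<Sum>i<m. L i)"
  let ?E = "exp (real CARD('n))"
  have P: "P i \<in> poly_space k" if "i \<le> m" for i
    using S that by (auto simp: P_def mem_Times_iff)
  have Q: "Q i \<in> poly_space k" if "i < m" for i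
    using that unfolding Q_def by (intro poly_space_diff P) auto
  have L0: "0 \<le> L i" for i unfolding L_def by (rule jet_max_nonneg)
  then have \<Lambda>0: "0 \<le> \<Lambda>" unfolding \<Lambda>_def by (intro sum_nonneg) auto
  have L_le: "L i \<le> \<Lambda>" if "i < m" for i
    unfolding \<Lambda>_def using that L0 by (intro member_le_sum) auto
  have bound_x: "\<omega> (norm (x i - x (Suc i))) \<le> L i" for i
    using jet_max_le_iff[of \<omega> k "P i" "x i"] unfolding L_def by blast
  have bound_Q: "phi \<omega> k \<alpha> \<bar>D_multi \<alpha> (Q i) (x i)\<bar> \<le> L i" if "mi_order \<alpha> \<le> k" for i \<alpha>
    using jet_max_le_iff[of \<omega> k "P i" "x i"] that unfolding L_def Q_def by blast
  have E1: "1 \<le> ?E" by simp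
  have \<Lambda>_E: "\<Lambda> \<le> ?E * \<Lambda>"
    using mult_right_mono[OF E1 \<Lambda>0] by simp
  have telescope: "\<bar>D_multi \<alpha> (\<lambda>y. P 0 y - P m y) z\<bar> \<le> (\<Sum>i<m. \<bar>D_multi \<alpha> (Q i) z\<bar>)" for \<alpha> z
  proof -
    have "D_multi \<alpha> (\<lambda>y. P 0 y - P m y) z = D_multi \<alpha> (P 0) z - D_multi \<alpha> (P m) z"
      by (rule D_multi_diff[OF P P]) auto
    also have "\<dots> = (\<Sum>i<m. D_multi \<alpha> (Q i) z)"
      unfolding Q_def sum_lessThan_telescope'[of "\<lambda>i. D_multi \<alpha> (P i) z", symmetric]
    proof (rule sum.cong)
      fix i assume "i \<in> {..<m}"
      then show "D_multi \<alpha> (P i) z - D_multi \<alpha> (P (Suc i)) z = D_multi \<alpha> (\<lambda>y. P i y - P (Suc i) y) z"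
        by (intro D_multi_diff[OF P P, symmetric]) auto
    qed simp
    finally show ?thesis by (simp add: sum_abs)
  qed
  \<comment> \<open>The point \<open>z\<close> runs over both end points because
    \<open>delta\<close> evaluates derivatives at both.\<close>
  have "\<omega> (norm (x 0 - x m)) \<le> ?E * \<Lambda> \<and>
    (\<forall>\<alpha> z. z \<in> {x 0, x m} \<longrightarrow> mi_order \<alpha> \<le> k \<longrightarrow>
      phi \<omega> k \<alpha> \<bar>D_multi \<alpha> (\<lambda>y. P 0 y - P m y) z\<bar> \<le> ?E * \<Lambda>)"
  proof (cases rule: range_cases[OF \<Lambda>0])
    case (1 r)
    \<comment> \<open>An \<open>L i\<close> above the whole range of \<omega> would exceed
      \<open>\<omega> r = \<Lambda>\<close>, although \<open>L i \<le> \<Lambda>\<close>.\<close>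
    have "\<exists>s\<ge>0. L i = \<omega> s" if "i < m" for i
    proof (cases rule: range_cases[OF L0[of i]])
      case 2
      then show ?thesis using 2[OF 1(1)] L_le[OF that] 1(2) by linarith
    qed blast
    then obtain \<rho> where \<rho>: "\<And>i. i < m \<Longrightarrow> 0 \<le> \<rho> i" "\<And>i. i < m \<Longrightarrow> L i = \<omega> (\<rho> i)"
      by metis
    have "\<omega> (\<Sum>i<m. \<rho> i) \<le> (\<Sum>i<m. \<omega> (\<rho> i))"
      using \<rho> by (intro sum_le) auto
    also have "\<dots> = \<omega> r" using 1 \<rho> by (simp add: \<Lambda>_def)
    finally have sum_\<rho>: "(\<Sum>i<m. \<rho> i) \<le> r" using 1 le_cancel by blast
    have step: "norm (x i - x (Suc i)) \<le> \<rho> i" if "i < m" for i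
      using bound_x[of i] \<rho>[OF that] by (simp add: le_cancel[of "\<rho> i"])
    have dist: "norm (x a - x b) \<le> r" if "a \<le> b" "b \<le> m" for a b
      using norm_diff_le_sum[of m x \<rho> a b] step that sum_\<rho> by fastforce
    have near: "norm (z - x i) \<le> r" if "z \<in> {x 0, x m}" "i < m" for z i
      using that dist[of 0 i] dist[of i m] by (auto simp: norm_minus_commute)
    have \<rho>_le: "\<rho> i \<le> r" if "i < m" for i
      using member_le_sum[of i "{..<m}" \<rho>] \<rho> that sum_\<rho> by fastforce
    have "phi \<omega> k \<alpha> \<bar>D_multi \<alpha> (\<lambda>y. P 0 y - P m y) z\<bar> \<le> ?E * \<Lambda>"
      if z: "z \<in> {x 0, x m}" and \<alpha>: "mi_order \<alpha> \<le> k" for \<alpha> z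
    proof -
      let ?j = "k - mi_order \<alpha>"
      have "\<bar>D_multi \<alpha> (Q i) z\<bar> \<le> ?E * (r ^ ?j * L i)" if i: "i < m" for i
      proof (rule D_multi_transport[OF Q[OF i] \<alpha> near[OF z i]])
        fix \<beta> :: "'n \<Rightarrow> nat"
        assume le: "mi_order \<alpha> + mi_order \<beta> \<le> k"
        let ?\<gamma> = "\<lambda>i. \<alpha> i + \<beta> i"
        have "\<bar>D_multi ?\<gamma> (Q i) (x i)\<bar> \<le> \<rho> i ^ (k - mi_order ?\<gamma>) * \<omega> (\<rho> i)"
          using bound_Q[of ?\<gamma> i] le i \<rho> by (intro phi_le_imp_le) (auto simp: mi_order_add)
        \<comment> \<open>Only the power is enlarged from \<open>\<rho> i\<close> to
          \<open>r\<close>. The factor \<open>\<omega> (\<rho> i) = L i\<close> is kept, so that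
          summation over \<open>i\<close> yields \<open>\<Lambda> = \<omega> r\<close> and no factor
          \<open>m\<close>.\<close>
        also have "\<dots> \<le> r ^ (k - mi_order ?\<gamma>) * \<omega> (\<rho> i)"
          using \<rho> \<rho>_le i nonneg by (intro mult_right_mono power_mono) auto
        finally show "\<bar>D_multi ?\<gamma> (Q i) (x i)\<bar> \<le> r ^ (k - mi_order \<alpha> - mi_order \<beta>) * L i"
          using \<rho> i by (simp add: mi_order_add)
      qed
      then have "(\<Sum>i<m. \<bar>D_multi \<alpha> (Q i) z\<bar>) \<le> (\<Sum>i<m. ?E * (r ^ ?j * L i))"
        by (intro sum_mono) auto
      with telescope[of \<alpha> z] have "\<bar>D_multi \<alpha> (\<lambda>y. P 0 y - P m y) z\<bar> \<le> (\<Sum>i<m. ?E * (r ^ ?j * L i))"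
        by linarith
      also have "\<dots> = ?E * (r ^ ?j * \<omega> r)"
        by (simp add: \<Lambda>_def sum_distrib_left flip: 1(2))
      finally show ?thesis
        unfolding 1(2) using \<alpha> 1 E1 by (intro phi_le_scaled) auto
    qed
    moreover have "\<omega> (norm (x 0 - x m)) \<le> \<Lambda>"
      unfolding 1(2) using dist[of 0 m] by (intro mono) auto
    ultimately show ?thesis using \<Lambda>_E order_trans by blast
  next
    case 2
    \<comment> \<open>For |\<alpha>| < \<open>k\<close> the left side is a value of \<omega>, hence
      below \<Lambda>. For |\<alpha>| = \<open>k\<close>, \<open>phi\<close> is the identity and the
      bounds at \<open>x i\<close> hold at every \<open>z\<close>.\<close>
    have "phi \<omega> k \<alpha> \<bar>D_multi \<alpha> (\<lambda>y. P 0 y - P m y) z\<bar> \<le> \<Lambda>"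
      if \<alpha>: "mi_order \<alpha> \<le> k" for \<alpha> z
    proof (cases "mi_order \<alpha> = k")
      case True
      have "(\<Sum>i<m. \<bar>D_multi \<alpha> (Q i) z\<bar>) \<le> \<Lambda>"
        unfolding \<Lambda>_def
      proof (rule sum_mono)
        fix i assume "i \<in> {..<m}"
        then have "D_multi \<alpha> (Q i) z = D_multi \<alpha> (Q i) (x i)"
          using True Q by (intro D_multi_top_order_const) auto
        then show "\<bar>D_multi \<alpha> (Q i) z\<bar> \<le> L i"
          using bound_Q[of \<alpha> i] True by (simp add: phi_def)
      qed
      with telescope[of \<alpha> z] True show ?thesis by (simp add: phi_def)
    qed (use \<alpha> in \<open>simp add: less_imp_le phi_less_of_range_less[OF 2]\<close>)
    then show ?thesis
      using \<Lambda>_E less_imp_le[OF 2[OF norm_ge_zero, of "x 0 - x m"]] order_trans by blast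
  qed
  then have "delta \<omega> k (P 0, x 0) (P m, x m) \<le> ?E * \<Lambda>"
    unfolding delta_le_iff jet_max_le_iff by blast
  then show ?thesis by (simp add: \<Lambda>_def L_def P_def x_def)
qed

section \<open>Comparison with the infimum over chains\<close>

lemma delta_nonneg: "0 \<le> delta \<omega> k T T'"
  using jet_max_nonneg jet_max_le_delta by (rule order_trans)

text \<open>The one-step chain is admissible, and 0 bounds all chain sums from below, as a real
  infimum requires.\<close>

lemma d_chain_le_delta:
  assumes "T \<in> poly_space k \<times> UNIV" "T' \<in> poly_space k \<times> UNIV"
  shows "d_chain \<omega> k T T' \<le> delta \<omega> k T T'"
  unfolding d_chain_def
proof (rule cInf_lower)
  show "delta \<omega> k T T' \<in> {(\<Sum>i<m. delta \<omega> k (S i) (S (Suc i))) | m S.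
      (\<forall>i\<le>m. S i \<in> poly_space k \<times> UNIV) \<and> S 0 = T \<and> S m = T'}"
    using assms
    by (intro CollectI exI[of _ "1 :: nat"] exI[of _ "\<lambda>i. if i = 0 then T else T'"]) auto
qed (auto intro!: bdd_belowI[of _ 0] sum_nonneg delta_nonneg)

lemma delta_le_d_chain:
  fixes T T' :: "'n::finite jet"
  assumes "T \<in> poly_space k \<times> UNIV" "T' \<in> poly_space k \<times> UNIV"
  shows "exp (- real CARD('n)) * delta \<omega> k T T' \<le> d_chain \<omega> k T T'"
  unfolding d_chain_def
proof (rule cInf_greatest)
  \<comment> \<open>The one-step chain shows that the infimum is over a nonempty set, so a bound for
    every chain passes to it.\<close>
  have "\<exists>S. (\<forall>i\<le>1. S i \<in> poly_space k \<times> UNIV) \<and> S 0 = T \<and> S (1 :: nat) = T'"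
    using assms by (intro exI[of _ "\<lambda>i. if i = 0 then T else T'"]) auto
  then show "{(\<Sum>i<m. delta \<omega> k (S i) (S (Suc i))) | m S.
      (\<forall>i\<le>m. S i \<in> poly_space k \<times> UNIV) \<and> S 0 = T \<and> S m = T'} \<noteq> {}"
    by blast
next
  fix d assume "d \<in> {(\<Sum>i<m. delta \<omega> k (S i) (S (Suc i))) | m S.
      (\<forall>i\<le>m. S i \<in> poly_space k \<times> UNIV) \<and> S 0 = T \<and> S m = T'}"
  then obtain m S where S: "\<forall>i\<le>m. S i \<in> poly_space k \<times> UNIV" "S 0 = T" "S m = T'"
    and d: "d = (\<Sum>i<m. delta \<omega> k (S i) (S (Suc i)))" by blast
  have "delta \<omega> k T T' \<le> exp (real CARD('n)) * (\<Sum>i<m. jet_max \<omega> k (S i) (S (Suc i)))"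
    using delta_le_sum_jet_max[OF S(1)] S by simp
  also have "\<dots> \<le> exp (real CARD('n)) * d"
    unfolding d by (intro mult_left_mono sum_mono jet_max_le_delta) auto
  finally show "exp (- real CARD('n)) * delta \<omega> k T T' \<le> d"
    by (simp add: exp_minus field_simps)
qed

lemma delta_le_jet_max:
  fixes T T' :: "'n::finite jet"
  assumes "T \<in> poly_space k \<times> UNIV" "T' \<in> poly_space k \<times> UNIV"
  shows "delta \<omega> k T T' \<le> exp (real CARD('n)) * jet_max \<omega> k T T'"
  using delta_le_sum_jet_max[of 1 "\<lambda>i. if i = 0 then T else T'" k] assms by simp

end

theorem proposition2p5:
  fixes \<omega> :: "real \<Rightarrow> real" and k :: nat
    and P P' :: "real^'n::finite \<Rightarrow> real" and x x' :: "real^'n"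
  assumes "k \<ge> 1"
    and "\<omega> \<in> {0..} \<rightarrow> {0..}"
    and "continuous_on {0..} \<omega>"
    and "concave_on {0..} \<omega>"
    and "strict_mono_on {0..} \<omega>"
    and "\<omega> 0 = 0"
    and "P \<in> poly_space k" and "P' \<in> poly_space k"
  shows "(exp (- real CARD('n)) * delta \<omega> k (P, x) (P', x') \<le> d_chain \<omega> k (P, x) (P', x') \<and>
         d_chain \<omega> k (P, x) (P', x') \<le> delta \<omega> k (P, x) (P', x')) \<and>
        (exp (- real CARD('n)) * d_chain \<omega> k (P, x) (P', x') \<le> jet_max \<omega> k (P, x) (P', x') \<and>
         jet_max \<omega> k (P, x) (P', x') \<le> exp (real CARD('n)) * d_chain \<omega> k (P, x) (P', x'))"
proof -
  interpret modulus \<omega> using assms by unfold_locales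
  have T: "(P, x) \<in> poly_space k \<times> UNIV" "(P', x') \<in> poly_space k \<times> UNIV"
    using assms by auto
  \<comment> \<open>The second pair of inequalities combines these with
    \<open>jet_max \<le> delta \<le> e^n * jet_max\<close>.\<close>
  note lower = delta_le_d_chain[OF T] and upper = d_chain_le_delta[OF T]
  have "d_chain \<omega> k (P, x) (P', x') \<le> exp (real CARD('n)) * jet_max \<omega> k (P, x) (P', x')"
    using upper delta_le_jet_max[OF T] by (rule order_trans)
  then have "exp (- real CARD('n)) * d_chain \<omega> k (P, x) (P', x') \<le> jet_max \<omega> k (P, x) (P', x')"
    by (simp add: exp_minus field_simps)
  moreover have "delta \<omega> k (P, x) (P', x') \<le> exp (real CARD('n)) * d_chain \<omega> k (P, x) (P', x')"
    using lower by (simp add: exp_minus field_simps)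
  then have "jet_max \<omega> k (P, x) (P', x') \<le> exp (real CARD('n)) * d_chain \<omega> k (P, x) (P', x')"
    by (rule order_trans[OF jet_max_le_delta])
  ultimately show ?thesis using lower upper by blast
qed

end
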